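(* The 2-bridge knots $9_{21}$, $9_{23}$, $9_{26}$ and $9_{31}$ have H(2)-unknotting number one.
   Context: Knot names are those of Rolfsen's table. A knot is not distinguished from its mirror image here; up to mirror image, $9_{21}=S(43,25)$, $9_{23}=S(45,64)$, $9_{26}=S(47,81)$, $9_{31}=S(55,144)$, where $S(p,q)$ denotes the 2-bridge link characterized as the unique link in $S^3$ whose double branched cover is the lens space $L(p,q)$ ($L(p,q)$ being $p/q$-surgery on the trivial knot). An H(2)-move is the local transformation of link diagrams which, inside a disk meeting the (unoriented) link in two parallel unknotted arcs, replaces the two arcs by the other pair of parallel crossingless arcs with the same four endpoints (i.e. replaces $)($ by its rotation through $90^\circ$); equivalently, it is surgery of the unoriented link along a single band, with no condition on orientations. The H(2)-unknotting number $u_2(L)$ of a link $L$ is the minimal number of H(2)-moves needed to change $L$ into the unknot. *)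

theory Defs
  imports Main "HOL-Library.Extended_Nat"
begin

text \<open>
  An unoriented link diagram in the plane is brought, by a planar isotopy, into Morse position
  with respect to the height function and is then read from bottom to top as a word of pieces
  occurring at pairwise different heights. The entry \<open>(p, i)\<close> says that the piece \<open>p\<close> sits on the
  strands in positions \<open>i, i + 1\<close> (counted from the left, starting at 0) and that all other
  strands pass vertically:

    \<^item> \<open>Cup\<close> is a local minimum, which creates the two strands \<open>i, i + 1\<close>;
    \<^item> \<open>Cap\<close> is a local maximum, which joins the two strands \<open>i, i + 1\<close>;
    \<^item> \<open>Crs b\<close> is a crossing of the strands \<open>i, i + 1\<close>. For \<open>b = True\<close> the strand running from
      bottom left to top right is the overcrossing one, for \<open>b = False\<close> it is the other strand.
\<close>

datatype piece = Cup | Cap | Crs bool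

type_synonym diagram = "(piece \<times> nat) list"

fun inputs :: "piece \<Rightarrow> nat" where
  "inputs Cup = 0"
| "inputs Cap = 2"
| "inputs (Crs b) = 2"

fun outputs :: "piece \<Rightarrow> nat" where
  "outputs Cup = 2"
| "outputs Cap = 0"
| "outputs (Crs b) = 2"

text \<open>
  \<open>strands m w\<close> is the number of strands above the tangle word \<open>w\<close> when there are \<open>m\<close> strands
  below it, and \<open>None\<close> if some piece does not fit.
\<close>

fun strands :: "nat \<Rightarrow> diagram \<Rightarrow> nat option" where
  "strands m [] = Some m"
| "strands m ((p, i) # w) =
     (if i + inputs p \<le> m then strands (m - inputs p + outputs p) w else None)"

definition link_diagram :: "diagram \<Rightarrow> bool" where
  "link_diagram D \<longleftrightarrow> strands 0 D = Some 0"

text \<open>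
  Local moves generating isotopy of unoriented links on diagrams in Morse position.
  The rules \<open>exchange\<close>, \<open>zigzag1\<close>, \<open>zigzag2\<close>, \<open>slide_cup\<close> and \<open>slide_cap\<close> generate planar isotopy
  (\<open>exchange\<close> interchanges the heights of two consecutive pieces with disjoint supports; the
  \<open>slide\<close> rules rotate a crossing past a local extremum), the others are the three Reidemeister
  moves. The remaining sign and position variants of the Reidemeister moves follow from those
  listed here.
\<close>

inductive local_move :: "diagram \<Rightarrow> diagram \<Rightarrow> bool" where
  exchange: "i + inputs p \<le> k \<Longrightarrow>
     local_move [(q, k), (p, i)] [(p, i), (q, k - inputs p + outputs p)]"
| zigzag1: "local_move [(Cup, i), (Cap, i + 1)] []"
| zigzag2: "local_move [(Cup, i + 1), (Cap, i)] []"
| slide_cup: "local_move [(Cup, i), (Crs b, i + 1)] [(Cup, i + 1), (Crs (\<not> b), i)]"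
| slide_cap: "local_move [(Crs b, i + 1), (Cap, i)] [(Crs (\<not> b), i), (Cap, i + 1)]"
| R1_cup: "local_move [(Cup, i), (Crs b, i)] [(Cup, i)]"
| R1_cap: "local_move [(Crs b, i), (Cap, i)] [(Cap, i)]"
| R2: "local_move [(Crs b, i), (Crs (\<not> b), i)] []"
| R3: "local_move [(Crs b, i), (Crs b, i + 1), (Crs b, i)]
                  [(Crs b, i + 1), (Crs b, i), (Crs b, i + 1)]"

text \<open>An \<open>H(2)\<close>-move replaces two neighbouring vertical arcs by a cap below a cup.\<close>

inductive local_H2 :: "diagram \<Rightarrow> diagram \<Rightarrow> bool" where
  "local_H2 [] [(Cap, i), (Cup, i)]"

text \<open>
  Applying a local move somewhere inside a link diagram. That both words are link diagrams
  guarantees that the two local words fit at the chosen place.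
\<close>

definition in_diagram :: "(diagram \<Rightarrow> diagram \<Rightarrow> bool) \<Rightarrow> diagram \<Rightarrow> diagram \<Rightarrow> bool" where
  "in_diagram M D E \<longleftrightarrow> link_diagram D \<and> link_diagram E \<and>
     (\<exists>u v x y. D = u @ x @ v \<and> E = u @ y @ v \<and> M x y)"

definition isotopic :: "diagram \<Rightarrow> diagram \<Rightarrow> bool" where
  "isotopic = equivclp (in_diagram local_move)"

definition H2_move :: "diagram \<Rightarrow> diagram \<Rightarrow> bool" where
  "H2_move = symclp (in_diagram local_H2)"

definition unknot :: diagram where
  "unknot = [(Cup, 0), (Cap, 0)]"

definition unknots_by_H2_moves :: "diagram \<Rightarrow> nat \<Rightarrow> bool" where
  "unknots_by_H2_moves D n \<longleftrightarrow>
     (\<exists>E. ((isotopic OO H2_move OO isotopic) ^^ n) D E \<and> isotopic E unknot)"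

text \<open>The value would be \<open>\<infinity>\<close> if no sequence of \<open>H(2)\<close>-moves led to the unknot.\<close>

definition H2_unknotting_number :: "diagram \<Rightarrow> enat" where
  "H2_unknotting_number D = Inf {enat n | n. unknots_by_H2_moves D n}"

definition mirror :: "diagram \<Rightarrow> diagram" where
  "mirror = map (\<lambda>(p, i). (case p of Crs b \<Rightarrow> Crs (\<not> b) | _ \<Rightarrow> p, i))"

definition isotopic_up_to_mirror :: "diagram \<Rightarrow> diagram \<Rightarrow> bool" where
  "isotopic_up_to_mirror D K \<longleftrightarrow> isotopic D K \<or> isotopic D (mirror K)"

text \<open>
  The 2-bridge diagram with Conway notation \<open>a\<^sub>1 a\<^sub>2 \<dots> a\<^sub>n\<close> (Conway normal form, a 4-plat):
  \<open>a\<^sub>1\<close> crossings between the two middle strands, \<open>a\<^sub>2\<close> crossings between the two left strands,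
  and so on alternately. Crossings of the two kinds have opposite signs, so the diagram is
  alternating. The plat closure at the top is the one for which the last twist region is not
  undone by Reidemeister I moves. The double branched cover is, up to orientation, the lens
  space \<open>L(p, q)\<close> with \<open>p / q = a\<^sub>n + 1 / (a\<^sub>n\<^sub>-\<^sub>1 + \<dots> + 1 / a\<^sub>1)\<close>.
\<close>

fun twist_regions :: "bool \<Rightarrow> nat list \<Rightarrow> diagram" where
  "twist_regions middle [] =
     (if middle then [(Cap, 1), (Cap, 0)] else [(Cap, 0), (Cap, 0)])"
| "twist_regions middle (a # as) =
     replicate a (Crs middle, if middle then 1 else 0) @ twist_regions (\<not> middle) as"

definition conway_diagram :: "nat list \<Rightarrow> diagram" where
  "conway_diagram as = [(Cup, 0), (Cup, 2)] @ twist_regions True as"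

text \<open>
  Knots of Rolfsen's table, by the Conway notation given there. The fractions are
  \<open>43/18\<close>, \<open>45/19\<close>, \<open>47/18\<close> and \<open>55/21\<close>. Since \<open>25 \<equiv> -18\<close> (mod 43), \<open>64 \<equiv> 19\<close> (mod 45),
  \<open>81 * 18 \<equiv> 1\<close> (mod 47) and \<open>144 \<equiv> -21\<close> (mod 55), these are, up to mirror image,
  \<open>S(43, 25)\<close>, \<open>S(45, 64)\<close>, \<open>S(47, 81)\<close> and \<open>S(55, 144)\<close>.
\<close>

definition knot_9_21 :: diagram where
  "knot_9_21 = conway_diagram [3, 1, 1, 2, 2]"

definition knot_9_23 :: diagram where
  "knot_9_23 = conway_diagram [2, 2, 1, 2, 2]"

definition knot_9_26 :: diagram where
  "knot_9_26 = conway_diagram [3, 1, 1, 1, 1, 2]"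

definition knot_9_31 :: diagram where
  "knot_9_31 = conway_diagram [2, 1, 1, 1, 1, 1, 2]"

lemma link_diagram_knots:
  "K \<in> {knot_9_21, knot_9_23, knot_9_26, knot_9_31} \<Longrightarrow> link_diagram K \<and> link_diagram (mirror K)"
  by (auto simp: link_diagram_def mirror_def conway_diagram_def eval_nat_numeral
      knot_9_21_def knot_9_23_def knot_9_26_def knot_9_31_def)

end

theory Submission
  imports Defs
begin

text \<open>
  None of the knots is trivial, because its determinant \<open>p\<close> (43, 45, 47 or 55) yields a
  nonconstant Fox \<open>p\<close>-colouring, whereas the unknot has only the \<open>p\<close> constant ones. For the
  upper bound, a finger of one strand is pushed next to another strand of the 2-bridge diagram,
  with a half twist or across one strand, and fused there with an \<open>H(2)\<close>-move; the resulting
  diagram of at most 11 crossings can be untangled explicitly. The bands and the isotopies were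
  found by a computer search.
\<close>

section \<open>Fox colourings\<close>

text \<open>Colours are listed from left to right. The outcome is a set because a cup may take any
  of the \<open>p\<close> colours and a cap may admit none. A crossing follows Fox's rule: the
  overstrand keeps its colour and the understrand is reflected in it.\<close>

fun colour_piece :: "int \<Rightarrow> piece \<Rightarrow> int list \<Rightarrow> int list set" where
  "colour_piece p Cup xs = (\<lambda>c. [c, c]) ` {0..<p}"
| "colour_piece p Cap xs = (if xs ! 0 = xs ! 1 then {[]} else {})"
| "colour_piece p (Crs b) xs =
     {if b then [(2 * xs ! 0 - xs ! 1) mod p, xs ! 0] else [xs ! 1, (2 * xs ! 1 - xs ! 0) mod p]}"

text \<open>A state sum over all colourings of the word with colours \<open>xs\<close> at the
  bottom, each weighted by \<open>f\<close> of its colours at the top. With an arbitrary weight, the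
  upper part of a diagram can serve as the weight for the part below it.\<close>

fun colour_sum :: "int \<Rightarrow> diagram \<Rightarrow> (int list \<Rightarrow> nat) \<Rightarrow> int list \<Rightarrow> nat" where
  "colour_sum p [] f xs = f xs"
| "colour_sum p ((a, i) # w) f xs =
     (\<Sum>ys\<in>colour_piece p a (take (inputs a) (drop i xs)).
        colour_sum p w f (take i xs @ ys @ drop (i + inputs a) xs))"

definition colourings :: "int \<Rightarrow> diagram \<Rightarrow> nat" where
  "colourings p D = colour_sum p D (\<lambda>_. 1) []"

lemma length_colour_piece: "ys \<in> colour_piece p a xs \<Longrightarrow> length ys = outputs a"
  by (cases a) (auto split: if_splits)

lemma set_colour_piece:
  "\<lbrakk>ys \<in> colour_piece p a xs; length xs = inputs a; set xs \<subseteq> {0..<p}; p > 0\<rbrakk> \<Longrightarrow> set ys \<subseteq> {0..<p}"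
  by (cases a) (auto split: if_splits simp: numeral_2_eq_2 length_Suc_conv)

lemma colour_sum_append: "colour_sum p (u @ w) f = colour_sum p u (colour_sum p w f)"
proof
  show "colour_sum p (u @ w) f xs = colour_sum p u (colour_sum p w f) xs" for xs
    by (induction u arbitrary: xs) auto
qed

lemma strands_append:
  "strands m (u @ w) = (case strands m u of None \<Rightarrow> None | Some k \<Rightarrow> strands k w)"
  by (induction m u rule: strands.induct) auto

text \<open>Only colour lists that can leave \<open>u\<close> at the top contribute, and these have
  length \<open>m\<close> and reduced entries. On such lists the words above \<open>u\<close> are
  compared when a local move is applied.\<close>

lemma colour_sum_cong:
  assumes "strands (length xs) u = Some m" "set xs \<subseteq> {0..<p}" "p > 0"
    and "\<And>ys. length ys = m \<Longrightarrow> set ys \<subseteq> {0..<p} \<Longrightarrow> f ys = g ys"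
  shows "colour_sum p u f xs = colour_sum p u g xs"
  using assms(1,2)
proof (induction u arbitrary: xs)
  case Nil
  then show ?case using assms(4) by auto
next
  case (Cons x u)
  obtain a i where x: "x = (a, i)" by force
  have fits: "i + inputs a \<le> length xs"
    and u: "strands (length xs - inputs a + outputs a) u = Some m"
    using Cons.prems(1) by (auto simp: x split: if_splits)
  show ?case unfolding x colour_sum.simps
  proof (rule sum.cong[OF refl], rule Cons.IH)
    fix ys assume ys: "ys \<in> colour_piece p a (take (inputs a) (drop i xs))"
    show "strands (length (take i xs @ ys @ drop (i + inputs a) xs)) u = Some m"
      using fits u length_colour_piece[OF ys] by (simp add: algebra_simps)
    have "set ys \<subseteq> {0..<p}"
      using ys by (rule set_colour_piece)
        (use fits Cons.prems(2) assms(3) in \<open>auto dest!: in_set_takeD in_set_dropD\<close>)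
    then show "set (take i xs @ ys @ drop (i + inputs a) xs) \<subseteq> {0..<p}"
      using Cons.prems(2) by (auto dest!: in_set_takeD in_set_dropD)
  qed
qed

section \<open>Invariance of the colour sum under local moves\<close>

lemma colour_sum_at:
  assumes "length A = i" "length s = inputs a"
  shows "colour_sum p ((a, i) # w) f (A @ s @ C) =
           (\<Sum>ys\<in>colour_piece p a s. colour_sum p w f (A @ ys @ C))"
  using assms by simp

lemma split_at:
  assumes "i + n \<le> length xs"
  obtains A s C where "xs = A @ s @ C" "length A = i" "length s = n"
proof
  show "xs = take i xs @ take n (drop i xs) @ drop n (drop i xs)" by (simp only: append_take_drop_id)
qed (use assms in auto)

lemma split_two:
  assumes "i + n \<le> k" "k + m \<le> length xs"
  obtains A s B t C where "xs = A @ s @ B @ t @ C" "length A = i" "length s = n"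
    "length B = k - i - n" "length t = m"
proof -
  obtain X t C where X: "xs = X @ t @ C" "length X = k" "length t = m"
    using split_at[OF assms(2)] .
  obtain A s B where "X = A @ s @ B" "length A = i" "length s = n"
    using split_at[of i n X] assms X by auto
  with X show ?thesis by (intro that[of A s B t C]) auto
qed

text \<open>The two pieces act on disjoint blocks \<open>s\<close> and \<open>t\<close> of the
  colour list, so their outcomes are chosen independently and the two sums can be swapped.\<close>

lemma colour_sum_exchange:
  assumes "i + inputs a \<le> k" "k + inputs b \<le> length xs"
  shows "colour_sum p [(b, k), (a, i)] f xs =
         colour_sum p [(a, i), (b, k - inputs a + outputs a)] f xs"
proof -
  obtain A s B t C where xs: "xs = A @ s @ B @ t @ C" "length A = i" "length s = inputs a"
    "length B = k - i - inputs a" "length t = inputs b"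
    using split_two[OF assms] .
  have "colour_sum p [(b, k), (a, i)] f ((A @ s @ B) @ t @ C) =
      (\<Sum>zs\<in>colour_piece p b t. colour_sum p [(a, i)] f ((A @ s @ B) @ zs @ C))"
    by (rule colour_sum_at) (use xs assms in auto)
  also have "\<dots> = (\<Sum>zs\<in>colour_piece p b t. \<Sum>ys\<in>colour_piece p a s. f (A @ ys @ B @ zs @ C))"
    using xs by (intro sum.cong refl) simp
  also have "\<dots> = (\<Sum>ys\<in>colour_piece p a s. \<Sum>zs\<in>colour_piece p b t. f (A @ ys @ B @ zs @ C))"
    by (rule sum.swap)
  also have "\<dots> = (\<Sum>ys\<in>colour_piece p a s.
      colour_sum p [(b, k - inputs a + outputs a)] f (A @ ys @ (B @ t @ C)))"
  proof (rule sum.cong[OF refl])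
    fix ys assume "ys \<in> colour_piece p a s"
    then have "length ys = outputs a" by (rule length_colour_piece)
    then have "colour_sum p [(b, k - inputs a + outputs a)] f ((A @ ys @ B) @ t @ C) =
      (\<Sum>zs\<in>colour_piece p b t. colour_sum p [] f ((A @ ys @ B) @ zs @ C))"
      using xs assms by (intro colour_sum_at) auto
    then show "(\<Sum>zs\<in>colour_piece p b t. f (A @ ys @ B @ zs @ C)) =
      colour_sum p [(b, k - inputs a + outputs a)] f (A @ ys @ (B @ t @ C))"
      by (simp only: append_assoc colour_sum.simps(1))
  qed
  also have "\<dots> = colour_sum p [(a, i), (b, k - inputs a + outputs a)] f (A @ s @ (B @ t @ C))"
    by (rule colour_sum_at[symmetric]) (use xs in auto)
  finally show ?thesis unfolding xs(1) by (simp only: append_assoc)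
qed

lemma colour_sum_cup:
  assumes "length A = i"
  shows "colour_sum p ((Cup, i) # w) f (A @ C) = (\<Sum>c\<in>{0..<p}. colour_sum p w f (A @ c # c # C))"
  using assms by (simp add: sum.reindex inj_on_def)

lemma colour_sum_cap:
  assumes "length A = i"
  shows "colour_sum p ((Cap, i) # w) f (A @ x # y # C) = (if x = y then colour_sum p w f (A @ C) else 0)"
  using assms by (simp add: numeral_2_eq_2)

lemma colour_sum_crs:
  assumes "length A = i"
  shows "colour_sum p ((Crs b, i) # w) f (A @ x # y # C) =
    colour_sum p w f (A @ (if b then (2 * x - y) mod p # x # C else y # (2 * y - x) mod p # C))"
  using assms by (simp add: numeral_2_eq_2)

text \<open>The same evaluations one place further right, past the strand \<open>z\<close>: local
  moves mix the positions \<open>i\<close> and \<open>i + 1\<close>, and one splitting of the list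
  at \<open>A\<close> has to serve both.\<close>

lemma colour_sum_Suc:
  assumes "length A = i"
  shows colour_sum_cup_Suc: "colour_sum p ((Cup, Suc i) # w) f (A @ z # C) =
      (\<Sum>c\<in>{0..<p}. colour_sum p w f (A @ z # c # c # C))"
    and colour_sum_cap_Suc: "colour_sum p ((Cap, Suc i) # w) f (A @ z # x # y # C) =
      (if x = y then colour_sum p w f (A @ z # C) else 0)"
    and colour_sum_crs_Suc: "colour_sum p ((Crs b, Suc i) # w) f (A @ z # x # y # C) =
      colour_sum p w f (A @ z # (if b then (2 * x - y) mod p # x # C else y # (2 * y - x) mod p # C))"
  using colour_sum_cup[of "A @ [z]" "Suc i" p w f C] colour_sum_cap[of "A @ [z]" "Suc i" p w f x y C]
    colour_sum_crs[of "A @ [z]" "Suc i" p b w f x y C] assms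
  by simp_all

text \<open>Reflection in \<open>x\<close> is an involution fixing \<open>x\<close>, so no other
  residue is sent to \<open>x\<close>. Hence a cap above a crossing imposes the same condition as
  the cap alone.\<close>

lemma reflect_mod_eq_iff:
  fixes x y p :: int
  assumes "0 \<le> x" "x < p" "0 \<le> y" "y < p"
  shows "(2 * x - y) mod p = x \<longleftrightarrow> x = y" "x = (2 * x - y) mod p \<longleftrightarrow> x = y"
proof -
  have reflect: "(2 * x - (2 * x - y) mod p) mod p = y" using assms by (simp add: mod_simps)
  show "(2 * x - y) mod p = x \<longleftrightarrow> x = y"
  proof
    assume x: "(2 * x - y) mod p = x"
    have "(2 * x - x) mod p = y" using reflect unfolding x .
    then show "x = y" using assms by simp
  qed (use assms in simp)
  then show "x = (2 * x - y) mod p \<longleftrightarrow> x = y" by metis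
qed

lemma colour_sum_local_move:
  assumes "local_move x y" "strands (length xs) x \<noteq> None" "set xs \<subseteq> {0..<p}"
  shows "colour_sum p x f xs = colour_sum p y f xs"
proof -
  note [simp del] = colour_sum.simps(2)
  note [simp] = colour_sum_cup colour_sum_cap colour_sum_crs colour_sum_Suc
  \<comment> \<open>In every case but \<open>exchange\<close>, the \<open>n\<close> strands that
    enter the move from below are cut out of the list.\<close>
  have split: thesis
    if fit: "i + n \<le> length xs"
      and parts: "\<And>A s C. xs = A @ s @ C \<Longrightarrow> length A = i \<Longrightarrow> length s = n \<Longrightarrow> set s \<subseteq> {0..<p} \<Longrightarrow> thesis"
    for i n thesis
  proof -
    obtain A s C where "xs = A @ s @ C" "length A = i" "length s = n"
      using split_at[OF fit] .
    then show thesis using parts[of A s C] assms(3) by auto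
  qed
  show ?thesis
    using assms(1)
  proof cases
    case (exchange i a k b)
    then show ?thesis using assms(2) colour_sum_exchange[of i a k b xs p f]
      by (auto split: if_splits)
  next
    case (zigzag1 i)
    have "i + 1 \<le> length xs" using assms(2) zigzag1 by (auto split: if_splits)
    then obtain A s C where "xs = A @ s @ C" "length A = i" "length s = 1" "set s \<subseteq> {0..<p}"
      by (rule split)
    then show ?thesis by (auto simp: zigzag1 length_Suc_conv)
  next
    case (zigzag2 i)
    have "i + 1 \<le> length xs" using assms(2) zigzag2 by (auto split: if_splits)
    then obtain A s C where "xs = A @ s @ C" "length A = i" "length s = 1" "set s \<subseteq> {0..<p}"
      by (rule split)
    then show ?thesis by (auto simp: zigzag2 length_Suc_conv)
  next
    case (slide_cup i b)
    have "i + 1 \<le> length xs" using assms(2) slide_cup by (auto split: if_splits)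
    then obtain A s C where "xs = A @ s @ C" "length A = i" "length s = 1" "set s \<subseteq> {0..<p}"
      by (rule split)
    then obtain y where y: "xs = A @ y # C" "length A = i" "0 \<le> y" "y < p"
      by (auto simp: length_Suc_conv)
    \<comment> \<open>If \<open>y\<close> is the overstrand, the two sides name the colour of the
      new arc on opposite sides of it; reflection in \<open>y\<close> permutes the residues and
      matches the sums.\<close>
    have "(\<Sum>c = 0..<p. f (A @ c # y # (2 * y - c) mod p # C)) =
        (\<Sum>c = 0..<p. f (A @ (2 * y - c) mod p # y # c # C))"
      by (rule sum.reindex_bij_witness[where i = "\<lambda>c. (2 * y - c) mod p" and j = "\<lambda>c. (2 * y - c) mod p"])
        (auto simp: mod_simps)
    with y(2) show ?thesis unfolding slide_cup y(1) by (cases b) auto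
  next
    case (slide_cap b i)
    have "i + 3 \<le> length xs" using assms(2) slide_cap by (auto split: if_splits)
    then obtain A s C where "xs = A @ s @ C" "length A = i" "length s = 3" "set s \<subseteq> {0..<p}"
      by (rule split)
    then show ?thesis by (auto simp: slide_cap length_Suc_conv numeral_3_eq_3 mod_simps)
  next
    case (R1_cup i b)
    have "i + 0 \<le> length xs" using assms(2) R1_cup by (auto split: if_splits)
    then obtain A s C where "xs = A @ s @ C" "length A = i" "length s = 0" "set s \<subseteq> {0..<p}"
      by (rule split)
    then show ?thesis by (auto simp: R1_cup intro!: sum.cong)
  next
    case (R1_cap b i)
    have "i + 2 \<le> length xs" using assms(2) R1_cap by (auto split: if_splits)
    then obtain A s C where "xs = A @ s @ C" "length A = i" "length s = 2" "set s \<subseteq> {0..<p}"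
      by (rule split)
    then show ?thesis by (auto simp: R1_cap length_Suc_conv numeral_2_eq_2 reflect_mod_eq_iff)
  next
    case (R2 b i)
    have "i + 2 \<le> length xs" using assms(2) R2 by (auto split: if_splits)
    then obtain A s C where "xs = A @ s @ C" "length A = i" "length s = 2" "set s \<subseteq> {0..<p}"
      by (rule split)
    then show ?thesis by (auto simp: R2 length_Suc_conv numeral_2_eq_2 mod_simps)
  next
    case (R3 b i)
    have "i + 3 \<le> length xs" using assms(2) R3 by (auto split: if_splits)
    then obtain A s C where "xs = A @ s @ C" "length A = i" "length s = 3" "set s \<subseteq> {0..<p}"
      by (rule split)
    \<comment> \<open>Self-distributivity: reflection in \<open>x\<close> carries the reflection of
      \<open>z\<close> in \<open>y\<close> to the reflection of the image of \<open>z\<close> in the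
      image of \<open>y\<close>.\<close>
    moreover have "(2 * ((2 * x - y) mod p) - (2 * x - z) mod p) mod p =
        (2 * x - (2 * y - z) mod p) mod p" for x y z
    proof -
      have "(2 * ((2 * x - y) mod p) - (2 * x - z) mod p) mod p = (2 * (2 * x - y) - (2 * x - z)) mod p"
        by (rule mod_diff_cong) (simp_all only: mod_mult_right_eq mod_mod_trivial)
      also have "2 * (2 * x - y) - (2 * x - z) = 2 * x - (2 * y - z)" by simp
      finally show ?thesis by (simp add: mod_simps)
    qed
    ultimately show ?thesis by (auto simp: R3 length_Suc_conv numeral_3_eq_3)
  qed
qed

lemma colourings_in_diagram:
  assumes "in_diagram local_move D E" "p > 0"
  shows "colourings p D = colourings p E"
proof -
  from assms(1) obtain u v x y where D: "D = u @ x @ v" and E: "E = u @ y @ v"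
    and xy: "local_move x y" and "strands 0 D = Some 0"
    by (auto simp: in_diagram_def link_diagram_def)
  then obtain m where u: "strands (length ([] :: int list)) u = Some m" and x: "strands m x \<noteq> None"
    by (auto simp: strands_append split: option.splits)
  \<comment> \<open>The weight \<open>g\<close> stands for the sum over the part \<open>v\<close>
    above the move.\<close>
  have "colour_sum p u (colour_sum p x g) [] = colour_sum p u (colour_sum p y g) []" for g
    by (rule colour_sum_cong[OF u _ assms(2)]) (use x colour_sum_local_move[OF xy] in auto)
  then show ?thesis by (simp add: colourings_def D E colour_sum_append)
qed

lemma colourings_isotopic:
  assumes "isotopic D E" "p > 0"
  shows "colourings p D = colourings p E"
  using assms(1) unfolding isotopic_def
  by (induction rule: equivclp_induct) (use colourings_in_diagram assms(2) in auto)

section \<open>Colour counts of the unknot and of the four knots\<close>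

lemma colourings_unknot: "colourings p unknot = nat p"
  by (simp add: colourings_def unknot_def sum.reindex inj_on_def)

text \<open>Since \<open>2 * c - c = c\<close>, the constant colouring passes through every piece;
  it contributes 1 to a sum of nonnegative terms.\<close>

lemma colour_sum_constant:
  assumes "strands m w \<noteq> None" "c \<in> {0..<p}"
  shows "colour_sum p w (\<lambda>_. 1) (replicate m c) \<ge> 1"
  using assms(1)
proof (induction w arbitrary: m)
  case (Cons x w)
  obtain a i where x: "x = (a, i)" by force
  let ?xs = "replicate m c"
  have fits: "i + inputs a \<le> m" and w: "strands (m - inputs a + outputs a) w \<noteq> None"
    using Cons.prems by (auto simp: x split: if_splits)
  let ?S = "colour_piece p a (take (inputs a) (drop i ?xs))"
  let ?g = "\<lambda>ys. colour_sum p w (\<lambda>_. 1) (take i ?xs @ ys @ drop (i + inputs a) ?xs)"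
  have const: "replicate (outputs a) c \<in> ?S"
    using assms(2) fits by (cases a) (auto simp: numeral_2_eq_2)
  have "take i ?xs @ replicate (outputs a) c @ drop (i + inputs a) ?xs
      = replicate (m - inputs a + outputs a) c"
    using fits by (simp add: replicate_add[symmetric])
  then have "1 \<le> ?g (replicate (outputs a) c)" using Cons.IH[OF w] by simp
  also have "\<dots> = sum ?g {replicate (outputs a) c}" by simp
  also have "\<dots> \<le> sum ?g ?S"
    by (rule sum_mono2) (use const in \<open>cases a, auto\<close>)
  finally show ?case by (simp add: x)
qed auto

text \<open>
  Besides the \<open>p\<close> constant colourings there is the one that takes the values 0 and 1
  on the two cups.
\<close>

lemma colourings_plat_greater:
  assumes "strands 4 w = Some 0" "colour_sum p w (\<lambda>_. 1) [0, 0, 1, 1] \<ge> 1" "p > 1"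
  shows "colourings p ([(Cup, 0), (Cup, 2)] @ w) > nat p"
proof -
  let ?h = "\<lambda>(c, d). colour_sum p w (\<lambda>_. 1) [c, c, d, d]"
  \<comment> \<open>Colour pairs of the two cups: the diagonal for the constant colourings, and one
    pair off the diagonal. Restricting the sum to them drops only nonnegative terms.\<close>
  let ?S = "insert (0, 1) ((\<lambda>c. (c, c)) ` {0..<p})"
  have "colourings p ([(Cup, 0), (Cup, 2)] @ w) = (\<Sum>c\<in>{0..<p}. \<Sum>d\<in>{0..<p}. ?h (c, d))"
    by (simp add: colourings_def sum.reindex inj_on_def numeral_2_eq_2)
  also have "\<dots> = sum ?h ({0..<p} \<times> {0..<p})"
    by (simp add: sum.cartesian_product)
  also have "\<dots> \<ge> sum ?h ?S"
    by (rule sum_mono2) (use assms(3) in auto)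
  moreover have "sum ?h ?S \<ge> sum (\<lambda>_. 1) ?S"
  proof (rule sum_mono)
    fix cd assume "cd \<in> ?S"
    then show "1 \<le> ?h cd"
      using assms(2) colour_sum_constant[of 4 w _ p] assms(1) by (auto simp: numeral_eq_Suc)
  qed
  moreover have "sum (\<lambda>_. 1) ?S = Suc (nat p)"
  proof -
    have "(0, 1) \<notin> (\<lambda>c. (c, c)) ` {0..<p}" by auto
    then show ?thesis by (simp add: card_image inj_on_def)
  qed
  ultimately show ?thesis by linarith
qed

lemma not_isotopic_unknot:
  assumes "colourings p D > nat p" "p > 0"
  shows "\<not> isotopic D unknot"
  using assms colourings_isotopic[of D unknot p] colourings_unknot[of p] by auto

text \<open>Modulo the determinant, the colours \<open>[0, 0, 1, 1]\<close> above the two cups run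
  through all crossings and agree at the caps; the simplifier evaluates this for each diagram and
  its mirror image. Composite moduli such as 45 and 55 are no obstacle, since colourings are merely
  counted.\<close>

lemma knots_not_isotopic_unknot:
  assumes "K \<in> {knot_9_21, knot_9_23, knot_9_26, knot_9_31}"
  shows "\<not> isotopic K unknot" "\<not> isotopic (mirror K) unknot"
proof -
  have "\<exists>p > 0. colourings p K > nat p \<and> colourings p (mirror K) > nat p"
  proof -
    consider "K = knot_9_21" | "K = knot_9_23" | "K = knot_9_26" | "K = knot_9_31"
      using assms by auto
    then show ?thesis
    proof cases
      case 1
      have "colourings 43 K > nat 43" "colourings 43 (mirror K) > nat 43"
        unfolding 1 knot_9_21_def conway_diagram_def mirror_def map_append list.map case_prod_conv piece.case
        by (rule colourings_plat_greater; simp add: eval_nat_numeral)+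
      then show ?thesis by (intro exI[of _ 43]) auto
    next
      case 2
      have "colourings 45 K > nat 45" "colourings 45 (mirror K) > nat 45"
        unfolding 2 knot_9_23_def conway_diagram_def mirror_def map_append list.map case_prod_conv piece.case
        by (rule colourings_plat_greater; simp add: eval_nat_numeral)+
      then show ?thesis by (intro exI[of _ 45]) auto
    next
      case 3
      have "colourings 47 K > nat 47" "colourings 47 (mirror K) > nat 47"
        unfolding 3 knot_9_26_def conway_diagram_def mirror_def map_append list.map case_prod_conv piece.case
        by (rule colourings_plat_greater; simp add: eval_nat_numeral)+
      then show ?thesis by (intro exI[of _ 47]) auto
    next
      case 4
      have "colourings 55 K > nat 55" "colourings 55 (mirror K) > nat 55"
        unfolding 4 knot_9_31_def conway_diagram_def mirror_def map_append list.map case_prod_conv piece.case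
        by (rule colourings_plat_greater; simp add: eval_nat_numeral)+
      then show ?thesis by (intro exI[of _ 55]) auto
    qed
  qed
  then show "\<not> isotopic K unknot" "\<not> isotopic (mirror K) unknot"
    using not_isotopic_unknot by blast+
qed

section \<open>Mirror images\<close>

text \<open>The effect of \<open>mirror\<close> on one piece, named so that \<open>exchange\<close>,
  whose pieces are arbitrary, can be instantiated with mirrored pieces.\<close>

definition flip :: "piece \<Rightarrow> piece" where
  "flip a = (case a of Crs b \<Rightarrow> Crs (\<not> b) | _ \<Rightarrow> a)"

lemma mirror_mirror [simp]: "mirror (mirror D) = D"
  by (induction D) (auto simp: mirror_def split: piece.splits)

lemma strands_mirror: "strands m (mirror D) = strands m D"
  by (induction m D rule: strands.induct) (auto simp: mirror_def split: piece.splits)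

lemma mirror_unknot: "mirror unknot = unknot"
  by (simp add: mirror_def unknot_def)

text \<open>The rules are closed under changing all crossings at once: the instance at
  \<open>b\<close> becomes the one at \<open>\<not> b\<close>, and the position shift in
  \<open>exchange\<close> depends only on numbers of ends, which \<open>flip\<close>
  preserves.\<close>

lemma local_move_mirror: "local_move x y \<Longrightarrow> local_move (mirror x) (mirror y)"
proof (induction rule: local_move.induct)
  case (exchange i a k b)
  have inputs_flip: "inputs (flip p) = inputs p" "outputs (flip p) = outputs p" for p
    by (auto simp: flip_def split: piece.splits)
  show ?case
    using local_move.exchange[of i "flip a" k "flip b"] exchange
    by (simp add: mirror_def inputs_flip flip: flip_def)
next
  case (slide_cup i b)
  show ?case using local_move.slide_cup[of i "\<not> b"] by (simp add: mirror_def)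
next
  case (slide_cap b i)
  show ?case using local_move.slide_cap[of "\<not> b" i] by (simp add: mirror_def)
next
  case (R2 b i)
  show ?case using local_move.R2[of "\<not> b" i] by (simp add: mirror_def)
next
  case (R3 b i)
  show ?case using local_move.R3[of "\<not> b" i] by (simp add: mirror_def)
qed (simp_all only: mirror_def list.map case_prod_conv piece.case local_move.intros)

lemma local_H2_mirror: "local_H2 x y \<Longrightarrow> local_H2 (mirror x) (mirror y)"
  by (auto simp: local_H2.simps mirror_def)

text \<open>Changing crossings leaves strand counts alone, so link diagrams stay link diagrams. The
  relation \<open>M\<close> is a parameter in order to cover isotopy moves and band moves
  alike.\<close>

lemma in_diagram_mirror:
  assumes "in_diagram M D E" "\<And>x y. M x y \<Longrightarrow> M (mirror x) (mirror y)"
  shows "in_diagram M (mirror D) (mirror E)"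
proof -
  obtain u v x y where "D = u @ x @ v" "E = u @ y @ v" "M x y" "link_diagram D" "link_diagram E"
    using assms(1) by (auto simp: in_diagram_def)
  then show ?thesis unfolding in_diagram_def link_diagram_def strands_mirror
    using assms(2)[of x y]
    by (intro conjI exI[of _ "mirror u"] exI[of _ "mirror v"] exI[of _ "mirror x"] exI[of _ "mirror y"])
      (simp_all add: mirror_def)
qed

lemma isotopic_refl [simp]: "isotopic D D"
  and isotopic_sym: "isotopic D E \<Longrightarrow> isotopic E D"
  and isotopic_trans: "isotopic D E \<Longrightarrow> isotopic E F \<Longrightarrow> isotopic D F"
  unfolding isotopic_def by (auto intro: equivclp_sym equivclp_trans)

lemma isotopic_local_move: "in_diagram local_move D E \<Longrightarrow> isotopic D E"
  unfolding isotopic_def by (rule r_into_equivclp)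

lemma isotopic_mirror:
  assumes "isotopic D E"
  shows "isotopic (mirror D) (mirror E)"
  using assms unfolding isotopic_def
proof (induction rule: equivclp_induct)
  case (step y z)
  have "isotopic (mirror y) (mirror z)"
    using step(2) in_diagram_mirror[of local_move, OF _ local_move_mirror]
    by (auto intro: isotopic_local_move isotopic_sym)
  with step(3) show ?case by (fold isotopic_def) (rule isotopic_trans)
qed simp

lemma H2_move_mirror: "H2_move D E \<Longrightarrow> H2_move (mirror D) (mirror E)"
  unfolding H2_move_def symclp_def using in_diagram_mirror[of local_H2, OF _ local_H2_mirror] by blast

section \<open>Isotopies given by lists of local moves\<close>

definition crossing :: "piece \<Rightarrow> bool" where
  "crossing a \<longleftrightarrow> a = Crs True \<or> a = Crs False"

text \<open>An executable test for \<open>local_move\<close>, sorted by the lengths of the words: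
  zigzags and \<open>R2\<close>; then \<open>R1_cup\<close> and \<open>R1_cap\<close>; then
  \<open>exchange\<close> and the slides; then \<open>R3\<close>, where the set equation makes all
  six crossings alike.\<close>

fun is_local_move :: "diagram \<Rightarrow> diagram \<Rightarrow> bool" where
  "is_local_move [(a, i), (b, j)] [] \<longleftrightarrow>
     a = Cup \<and> b = Cap \<and> (j = Suc i \<or> i = Suc j) \<or> crossing a \<and> b = flip a \<and> j = i"
| "is_local_move [(a, i), (b, j)] [(c, k)] \<longleftrightarrow>
     j = i \<and> k = i \<and> (a = Cup \<and> crossing b \<and> c = Cup \<or> crossing a \<and> b = Cap \<and> c = Cap)"
| "is_local_move [(a, i), (b, j)] [(c, k), (d, l)] \<longleftrightarrow>
     j + inputs b \<le> i \<and> c = b \<and> k = j \<and> d = a \<and> l = i - inputs b + outputs b \<or>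
     a = Cup \<and> crossing b \<and> j = Suc i \<and> c = Cup \<and> k = Suc i \<and> d = flip b \<and> l = i \<or>
     crossing a \<and> b = Cap \<and> i = Suc j \<and> c = flip a \<and> k = j \<and> d = Cap \<and> l = Suc j"
| "is_local_move [(a, i), (b, j), (c, k)] [(d, l), (e, m), (f, n)] \<longleftrightarrow>
     crossing a \<and> {b, c, d, e, f} = {a} \<and> j = Suc i \<and> k = i \<and> l = j \<and> m = i \<and> n = j"
| "is_local_move _ _ = False"

lemma is_local_move: "is_local_move x y \<Longrightarrow> local_move x y"
proof (induction x y rule: is_local_move.induct)
  case (1 a i b j)
  then show ?case
    using local_move.zigzag1[of i] local_move.zigzag2[of j] local_move.R2[of True i]
      local_move.R2[of False i]
    by (auto simp: crossing_def flip_def)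
next
  case (2 a i b j c k)
  then show ?case
    by (auto simp: crossing_def intro: local_move.intros)
next
  case (3 a i b j c k d l)
  then show ?case
    using local_move.slide_cup[of i True] local_move.slide_cup[of i False]
      local_move.slide_cap[of True j] local_move.slide_cap[of False j] local_move.exchange[of j b i a]
    by (auto simp: crossing_def flip_def)
next
  case (4 a i b j c k d l e m f n)
  then show ?case
    using local_move.R3[of _ i] by (auto simp: crossing_def)
qed simp_all

text \<open>
  A step \<open>(n, k, y)\<close> replaces the \<open>k\<close> pieces from position \<open>n\<close> on by the word \<open>y\<close>.
\<close>

fun rewrite_steps :: "diagram \<Rightarrow> (nat \<times> nat \<times> diagram) list \<Rightarrow> diagram \<Rightarrow> bool" where
  "rewrite_steps D [] E = (D = E)"
| "rewrite_steps D ((n, k, y) # ss) E =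
     (let u = take n D; x = take k (drop n D); D' = u @ y @ drop k (drop n D)
      in (is_local_move x y \<or> is_local_move y x) \<and> strands 0 D' = Some 0 \<and> rewrite_steps D' ss E)"

text \<open>Each step is a local move read forwards or backwards, and the strand count checked after
  it keeps every intermediate word a link diagram, as \<open>in_diagram\<close> demands.\<close>

lemma rewrite_steps_isotopic: "rewrite_steps D ss E \<Longrightarrow> strands 0 D = Some 0 \<Longrightarrow> isotopic D E"
proof (induction D ss E rule: rewrite_steps.induct)
  case (2 D n k y ss E)
  define u x v where "u = take n D" and "x = take k (drop n D)" and "v = drop k (drop n D)"
  have D: "D = u @ x @ v" by (simp only: u_def x_def v_def append_take_drop_id)
  have D': "strands 0 (u @ y @ v) = Some 0" and move: "local_move x y \<or> local_move y x"
    and "rewrite_steps (u @ y @ v) ss E"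
    using 2(2) is_local_move by (auto simp: Let_def u_def x_def v_def)
  then have "isotopic (u @ y @ v) E"
    using 2(1) by (simp add: u_def v_def)
  moreover have "isotopic D (u @ y @ v)"
    using move
  proof
    assume "local_move x y"
    then show ?thesis using 2(3) D D'
      by (intro isotopic_local_move) (auto simp: in_diagram_def link_diagram_def)
  next
    assume "local_move y x"
    then show ?thesis using 2(3) D D'
      by (intro isotopic_sym[OF isotopic_local_move]) (auto simp: in_diagram_def link_diagram_def)
  qed
  ultimately show ?case by (rule isotopic_trans[rotated])
qed simp

section \<open>Explicit unknotting bands for the four knots\<close>

definition band_unknots :: "diagram \<Rightarrow> bool" where
  "band_unknots D \<longleftrightarrow> (\<exists>E F. isotopic D E \<and> H2_move E F \<and> isotopic F unknot)"

text \<open>The word is cut into \<open>u\<close> and \<open>v\<close> at the height of the band.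
  The list \<open>ss\<close> retracts the finger and is used in reverse to create it;
  \<open>ts\<close> untangles the diagram after the band move.\<close>

lemma band_unknotsI:
  assumes "rewrite_steps (u @ v) ss D" "rewrite_steps (u @ [(Cap, i), (Cup, i)] @ v) ts unknot"
    and "strands 0 (u @ v) = Some 0" "strands 0 (u @ [(Cap, i), (Cup, i)] @ v) = Some 0"
  shows "band_unknots D"
  unfolding band_unknots_def
proof (intro exI conjI)
  show "isotopic D (u @ v)"
    using assms by (intro isotopic_sym[OF rewrite_steps_isotopic])
  show "isotopic (u @ [(Cap, i), (Cup, i)] @ v) unknot"
    using assms by (intro rewrite_steps_isotopic)
  have "\<exists>u' v' x y. u @ v = u' @ x @ v' \<and> u @ [(Cap, i), (Cup, i)] @ v = u' @ y @ v' \<and> local_H2 x y"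
    by (intro exI[of _ u] exI[of _ v] exI[of _ "[]"] exI[of _ "[(Cap, i), (Cup, i)]"])
      (simp add: local_H2.intros)
  then show "H2_move (u @ v) (u @ [(Cap, i), (Cup, i)] @ v)"
    unfolding H2_move_def symclp_def in_diagram_def link_diagram_def using assms by blast
qed

text \<open>
  In each case \<open>u @ v\<close> is the diagram of the knot with the finger; its tip is the
  cap or cup next to which the \<open>H(2)\<close>-move takes place.
\<close>

lemma band_unknots_knot_9_21: "band_unknots knot_9_21"
proof (rule band_unknotsI)
  \<comment> \<open>Three exchanges carry the tip, a cup, up past crossings; then
    \<open>R1_cup\<close> removes the half twist and a zigzag retracts the finger.\<close>
  show "rewrite_steps
      ([(Cup, 0), (Cup, 2), (Crs True, 1), (Crs True, 1), (Cup, 3)] @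
       [(Crs True, 1), (Crs False, 0), (Crs True, 1), (Crs False, 3), (Cap, 2), (Crs False, 0),
       (Crs False, 0), (Crs True, 1), (Crs True, 1), (Cap, 0), (Cap, 0)])
      [(4, 2, [(Crs True, 1), (Cup, 3)]), (5, 2, [(Crs False, 0), (Cup, 3)]),
       (6, 2, [(Crs True, 1), (Cup, 3)]), (7, 2, [(Cup, 3)]), (7, 2, [])]
      knot_9_21"
    by code_simp
  \<comment> \<open>The first step straightens the zigzag formed by the tip and the cap of the band.
    Steps replacing 0 pieces insert a cancelling pair of crossings, one of which enters a third
    Reidemeister move.\<close>
  show "rewrite_steps
      ([(Cup, 0), (Cup, 2), (Crs True, 1), (Crs True, 1), (Cup, 3)] @
       [(Cap, 2), (Cup, 2)] @
       [(Crs True, 1), (Crs False, 0), (Crs True, 1), (Crs False, 3), (Cap, 2), (Crs False, 0),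
       (Crs False, 0), (Crs True, 1), (Crs True, 1), (Cap, 0), (Cap, 0)])
      [(4, 2, []), (4, 2, [(Cup, 1), (Crs False, 2)]), (3, 2, [(Cup, 1), (Crs True, 3)]),
       (2, 2, [(Cup, 1), (Crs True, 3)]), (1, 2, [(Cup, 1), (Cup, 4)]), (5, 2, [(Crs False, 0),
       (Crs False, 2)]), (4, 2, [(Crs False, 0), (Crs True, 3)]), (3, 2, [(Crs False, 0),
       (Crs True, 3)]), (2, 2, [(Crs False, 0), (Cup, 4)]), (1, 2, [(Cup, 0), (Crs True, 1)]),
       (0, 2, [(Cup, 0), (Cup, 2)]), (7, 2, [(Crs False, 3), (Crs True, 1)]),
       (8, 2, [(Crs False, 2), (Cap, 1)]), (6, 3, [(Crs False, 3), (Crs False, 2),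
       (Crs False, 3)]), (5, 2, []), (7, 0, [(Crs False, 2), (Crs True, 2)]),
       (5, 3, [(Crs False, 3), (Crs False, 2), (Crs False, 3)]), (4, 2, []),
       (3, 2, [(Crs False, 2), (Cup, 4)]), (6, 2, [(Crs False, 1), (Cap, 2)]),
       (5, 2, [(Crs False, 1), (Crs False, 3)]), (4, 2, [(Crs False, 1), (Cup, 4)]),
       (7, 2, [(Crs False, 0), (Cap, 2)]), (6, 2, [(Crs False, 0), (Crs False, 3)]),
       (5, 2, [(Crs False, 0), (Cup, 4)]), (8, 2, [(Crs False, 0), (Cap, 2)]),
       (7, 2, [(Crs False, 0), (Crs False, 3)]), (6, 2, [(Crs False, 0), (Cup, 4)]),
       (0, 2, [(Cup, 0), (Cup, 0)]), (1, 2, [(Cup, 1), (Crs False, 0)]), (2, 2, [(Crs False, 2),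
       (Crs False, 0)]), (1, 2, [(Cup, 2), (Crs True, 1)]), (0, 2, [(Cup, 0), (Cup, 0)]),
       (3, 3, [(Crs False, 1), (Crs False, 0), (Crs False, 1)]), (2, 2, []), (1, 2, [(Cup, 0)]),
       (1, 2, [(Cup, 1), (Crs True, 0)]), (2, 2, []), (1, 2, [(Cup, 2), (Cup, 1)]),
       (0, 2, [(Cup, 0), (Cup, 0)]), (2, 2, [(Crs False, 1), (Cup, 1)]), (3, 2, []), (2, 2, []),
       (1, 2, [(Cup, 1), (Crs False, 0)]), (2, 2, [(Cap, 0)]), (1, 2, [])]
      unknot"
    by code_simp
qed (code_simp+)

lemma band_unknots_knot_9_23: "band_unknots knot_9_23"
proof (rule band_unknotsI)
  \<comment> \<open>Here the tip is a cap. It is brought back across a strand by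
    \<open>slide_cap\<close> and \<open>R2\<close>, and two exchanges and a zigzag retract the
    finger.\<close>
  show "rewrite_steps
      ([(Cup, 0), (Cup, 2), (Crs True, 1), (Crs True, 1), (Crs False, 0), (Crs False, 0),
       (Cup, 2), (Crs True, 1), (Crs False, 0), (Crs False, 2), (Crs False, 3)] @
       [(Cap, 2), (Crs False, 0), (Crs True, 1), (Crs True, 1), (Cap, 0), (Cap, 0)])
      [(10, 2, [(Crs True, 2), (Cap, 3)]), (9, 2, []), (8, 2, [(Cap, 3), (Crs False, 0)]),
       (7, 2, [(Cap, 3), (Crs True, 1)]), (6, 2, [])]
      knot_9_23"
    by code_simp
  \<comment> \<open>This time the tip cancels against the cup of the band, in the second
    step.\<close>
  show "rewrite_steps
      ([(Cup, 0), (Cup, 2), (Crs True, 1), (Crs True, 1), (Crs False, 0), (Crs False, 0),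
       (Cup, 2), (Crs True, 1), (Crs False, 0), (Crs False, 2), (Crs False, 3)] @
       [(Cap, 1), (Cup, 1)] @
       [(Cap, 2), (Crs False, 0), (Crs True, 1), (Crs True, 1), (Cap, 0), (Cap, 0)])
      [(10, 2, [(Cap, 1), (Crs False, 1)]), (12, 2, []), (11, 0, [(Crs True, 0), (Crs False, 0)]),
       (12, 3, [(Crs False, 1), (Crs False, 0), (Crs False, 1)]), (14, 2, []),
       (12, 0, [(Crs True, 0), (Crs False, 0)]), (13, 3, [(Crs False, 1), (Crs False, 0),
       (Crs False, 1)]), (1, 2, [(Cup, 1), (Crs False, 2)]), (15, 2, []), (14, 2, [(Cap, 0)]),
       (14, 2, [(Cap, 2), (Cap, 0)]), (13, 2, [(Crs True, 2), (Cap, 1)]), (12, 2, [(Crs True, 2),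
       (Crs True, 0)]), (11, 2, [(Crs True, 2), (Crs True, 0)]), (10, 2, [(Crs True, 4),
       (Cap, 1)]), (9, 2, [(Crs True, 4), (Crs False, 2)]), (8, 2, [(Crs True, 4),
       (Crs False, 0)]), (7, 2, [(Crs True, 4), (Crs True, 1)]), (6, 2, [(Crs True, 2),
       (Cup, 2)]), (5, 2, [(Crs True, 2), (Crs False, 0)]), (4, 2, [(Crs True, 2),
       (Crs False, 0)]), (5, 0, [(Crs True, 1), (Crs False, 1)]), (3, 3, [(Crs True, 2),
       (Crs True, 1), (Crs True, 2)]), (2, 2, []), (1, 2, [(Cup, 1)]), (1, 2, [(Cup, 2),
       (Crs False, 1)]), (0, 2, [(Cup, 0), (Cup, 0)]), (1, 2, [(Cup, 1), (Crs True, 0)]),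
       (5, 0, [(Crs False, 1), (Crs True, 1)]), (3, 3, [(Crs False, 0), (Crs False, 1),
       (Crs False, 0)]), (2, 2, []), (1, 2, [(Cup, 1)]), (5, 2, [(Cup, 1), (Crs False, 2)]),
       (7, 2, [(Crs False, 2), (Crs False, 0)]), (8, 2, [(Crs True, 1), (Cap, 0)]),
       (9, 2, [(Crs True, 2), (Cap, 0)]), (10, 0, [(Crs True, 1), (Crs False, 1)]),
       (8, 3, [(Crs True, 2), (Crs True, 1), (Crs True, 2)]), (7, 2, []), (9, 0, [(Crs True, 1),
       (Crs False, 1)]), (7, 3, [(Crs True, 2), (Crs True, 1), (Crs True, 2)]), (6, 2, []),
       (5, 2, [(Cup, 1)]), (1, 2, [(Cup, 0), (Crs True, 1)]), (0, 2, [(Cup, 0), (Cup, 2)]),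
       (1, 2, [(Cup, 1), (Crs False, 2)]), (10, 2, [(Crs False, 1), (Cap, 0)]), (11, 2, [(Cap, 2),
       (Cap, 0)]), (10, 2, [(Crs True, 2), (Cap, 1)]), (9, 2, [(Crs True, 4), (Cap, 0)]),
       (8, 2, [(Crs True, 4), (Crs False, 1)]), (7, 2, [(Crs True, 4), (Crs False, 1)]),
       (6, 2, [(Crs True, 4), (Crs True, 2)]), (5, 2, [(Crs True, 2), (Cup, 1)]),
       (4, 2, [(Crs True, 2), (Crs False, 0)]), (5, 0, [(Crs True, 1), (Crs False, 1)]),
       (3, 3, [(Crs True, 2), (Crs True, 1), (Crs True, 2)]), (2, 2, []), (1, 2, [(Cup, 1)]),
       (1, 2, [(Cup, 2), (Crs False, 1)]), (0, 2, [(Cup, 0), (Cup, 0)]), (1, 2, [(Cup, 1),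
       (Crs True, 0)]), (5, 2, [(Cup, 2), (Crs False, 1)]), (9, 2, [(Cap, 3), (Cap, 0)]),
       (8, 2, [(Cap, 3), (Crs False, 1)]), (7, 2, [(Cap, 3), (Crs False, 1)]), (6, 2, [(Cap, 3),
       (Crs False, 1)]), (5, 2, []), (3, 3, [(Crs False, 0), (Crs False, 1), (Crs False, 0)]),
       (2, 2, []), (1, 2, [(Cup, 1)]), (1, 2, [(Cup, 0), (Crs True, 1)]), (2, 2, []),
       (1, 2, [(Cup, 1), (Crs True, 0)]), (2, 2, [(Cap, 0)]), (1, 2, [])]
      unknot"
    by code_simp
qed (code_simp+)

lemma band_unknots_knot_9_26: "band_unknots knot_9_26"
proof (rule band_unknotsI)
  \<comment> \<open>A reversed \<open>slide_cup\<close> and \<open>R2\<close> bring the tip back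
    across a strand; six exchanges and a zigzag retract the finger.\<close>
  show "rewrite_steps
      ([(Cup, 0), (Cup, 2), (Crs True, 1), (Crs True, 1), (Cup, 1)] @
       [(Crs False, 0), (Crs False, 1), (Crs True, 3), (Crs False, 2), (Crs True, 3),
       (Crs False, 2), (Crs True, 3), (Crs False, 2), (Cap, 1), (Crs False, 0), (Cap, 1),
       (Cap, 0)])
      [(4, 2, [(Cup, 0), (Crs True, 1)]), (5, 2, []), (4, 2, [(Crs True, 1), (Cup, 0)]),
       (5, 2, [(Crs False, 0), (Cup, 0)]), (6, 2, [(Crs True, 1), (Cup, 0)]),
       (7, 2, [(Crs False, 0), (Cup, 0)]), (8, 2, [(Crs True, 1), (Cup, 0)]),
       (9, 2, [(Crs False, 0), (Cup, 0)]), (10, 2, [])]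
      knot_9_26"
    by code_simp
  show "rewrite_steps
      ([(Cup, 0), (Cup, 2), (Crs True, 1), (Crs True, 1), (Cup, 1)] @
       [(Cap, 2), (Cup, 2)] @
       [(Crs False, 0), (Crs False, 1), (Crs True, 3), (Crs False, 2), (Crs True, 3),
       (Crs False, 2), (Crs True, 3), (Crs False, 2), (Cap, 1), (Crs False, 0), (Cap, 1),
       (Cap, 0)])
      [(4, 2, []), (4, 2, [(Crs False, 0), (Cup, 2)]), (5, 2, [(Cup, 1), (Crs True, 2)]),
       (6, 0, [(Crs False, 3), (Crs True, 3)]), (5, 2, [(Crs False, 1), (Cup, 1)]),
       (7, 3, [(Crs True, 2), (Crs True, 3), (Crs True, 2)]), (9, 2, []), (6, 0, [(Crs False, 0),
       (Crs True, 0)]), (4, 3, [(Crs False, 1), (Crs False, 0), (Crs False, 1)]), (3, 2, []),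
       (5, 0, [(Crs False, 0), (Crs True, 0)]), (3, 3, [(Crs False, 1), (Crs False, 0),
       (Crs False, 1)]), (2, 2, []), (1, 2, [(Crs False, 0), (Cup, 2)]), (0, 2, [(Cup, 0)]),
       (5, 2, [(Cup, 2), (Crs False, 1)]), (6, 2, [(Crs True, 3), (Crs False, 1)]),
       (5, 2, [(Cup, 3), (Crs False, 2)]), (7, 2, [(Crs True, 3), (Crs False, 1)]),
       (11, 2, [(Crs True, 1), (Cap, 2)]), (10, 2, [(Crs True, 1), (Crs True, 3)]),
       (12, 2, [(Crs False, 0), (Cap, 2)]), (11, 2, [(Crs False, 0), (Crs True, 3)]),
       (8, 0, [(Crs True, 2), (Crs False, 2)]), (9, 3, [(Crs False, 1), (Crs False, 2),
       (Crs False, 1)]), (11, 2, []), (10, 2, [(Crs False, 0), (Crs False, 2)]),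
       (9, 0, [(Crs True, 3), (Crs False, 3)]), (7, 3, [(Crs True, 2), (Crs True, 3),
       (Crs True, 2)]), (6, 2, []), (5, 2, [(Cup, 3)]), (7, 2, [(Crs False, 1), (Crs False, 3)]),
       (8, 2, [(Crs False, 0), (Crs False, 3)]), (9, 0, [(Crs True, 2), (Crs False, 2)]),
       (4, 2, [(Cup, 3), (Crs True, 0)]), (5, 2, [(Crs True, 2), (Crs True, 0)]),
       (10, 3, [(Crs False, 3), (Crs False, 2), (Crs False, 3)]), (12, 2, []),
       (11, 2, [(Cap, 2)]), (9, 0, [(Crs False, 1), (Crs True, 1)]), (7, 3, [(Crs False, 0),
       (Crs False, 1), (Crs False, 0)]), (6, 2, []), (10, 2, [(Crs True, 2), (Cap, 3)]),
       (11, 2, [(Cap, 1), (Cap, 1)]), (10, 2, [(Crs False, 1), (Cap, 2)]), (8, 0, [(Crs False, 2),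
       (Crs True, 2)]), (9, 3, [(Crs True, 1), (Crs True, 2), (Crs True, 1)]), (11, 2, []),
       (4, 2, [(Cup, 2), (Crs False, 3)]), (5, 2, [(Crs False, 1), (Crs False, 3)]),
       (6, 2, [(Crs False, 0), (Crs False, 3)]), (10, 2, [(Cap, 2)]), (9, 2, [(Crs False, 2),
       (Cap, 1)]), (10, 2, [(Cap, 3), (Cap, 1)]), (9, 2, [(Crs True, 3), (Cap, 2)]),
       (7, 0, [(Crs True, 2), (Crs False, 2)]), (3, 2, [(Cup, 2), (Crs True, 0)]),
       (8, 3, [(Crs False, 3), (Crs False, 2), (Crs False, 3)]), (10, 2, []), (9, 2, [(Cap, 2)]),
       (7, 0, [(Crs False, 1), (Crs True, 1)]), (5, 3, [(Crs False, 0), (Crs False, 1),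
       (Crs False, 0)]), (4, 2, []), (8, 2, [(Crs True, 2), (Cap, 3)]), (9, 2, [(Cap, 1),
       (Cap, 1)]), (3, 2, [(Cup, 1), (Crs True, 2)]), (2, 2, [(Cup, 1), (Crs False, 3)]),
       (1, 2, [(Cup, 1), (Cup, 4)]), (4, 2, [(Crs False, 0), (Crs True, 2)]),
       (3, 2, [(Crs False, 0), (Crs False, 3)]), (2, 2, [(Crs False, 0), (Cup, 4)]),
       (5, 3, [(Crs True, 1), (Crs True, 2), (Crs True, 1)]), (8, 2, [(Crs False, 1), (Cap, 2)]),
       (7, 2, []), (6, 2, [(Cap, 2)]), (5, 2, [(Crs False, 2), (Cap, 1)]), (6, 2, [(Cap, 3),
       (Cap, 1)]), (5, 2, [(Crs True, 3), (Cap, 2)]), (4, 2, []), (3, 2, [(Cap, 2), (Cup, 2)]),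
       (2, 2, [(Cap, 2), (Crs False, 0)]), (1, 2, []), (0, 2, [(Cup, 0)]), (1, 2, [])]
      unknot"
    by code_simp
qed (code_simp+)

lemma band_unknots_knot_9_31: "band_unknots knot_9_31"
proof (rule band_unknotsI)
  \<comment> \<open>A finger with a half twist again, now carried past five crossings.\<close>
  show "rewrite_steps
      ([(Cup, 0), (Cup, 2), (Crs True, 1), (Crs True, 1), (Crs False, 0), (Cup, 3)] @
       [(Crs True, 1), (Crs False, 0), (Crs True, 1), (Crs False, 0), (Crs True, 1),
       (Crs False, 3), (Cap, 2), (Crs True, 1), (Cap, 0), (Cap, 0)])
      [(5, 2, [(Crs True, 1), (Cup, 3)]), (6, 2, [(Crs False, 0), (Cup, 3)]),
       (7, 2, [(Crs True, 1), (Cup, 3)]), (8, 2, [(Crs False, 0), (Cup, 3)]),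
       (9, 2, [(Crs True, 1), (Cup, 3)]), (10, 2, [(Cup, 3)]), (10, 2, [])]
      knot_9_31"
    by code_simp
  show "rewrite_steps
      ([(Cup, 0), (Cup, 2), (Crs True, 1), (Crs True, 1), (Crs False, 0), (Cup, 3)] @
       [(Cap, 2), (Cup, 2)] @
       [(Crs True, 1), (Crs False, 0), (Crs True, 1), (Crs False, 0), (Crs True, 1),
       (Crs False, 3), (Cap, 2), (Crs True, 1), (Cap, 0), (Cap, 0)])
      [(5, 2, []), (1, 2, [(Cup, 1), (Crs False, 2)]), (10, 2, [(Crs False, 3), (Crs True, 1)]),
       (11, 2, [(Crs False, 2), (Cap, 1)]), (12, 2, [(Crs True, 3), (Cap, 1)]),
       (10, 0, [(Crs True, 2), (Crs False, 2)]), (11, 3, [(Crs False, 3), (Crs False, 2),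
       (Crs False, 3)]), (13, 2, []), (14, 2, [(Cap, 2), (Cap, 0)]), (13, 2, [(Cap, 4),
       (Cap, 1)]), (12, 2, [(Cap, 4), (Crs False, 2)]), (11, 2, [(Crs True, 4), (Cap, 3)]),
       (10, 2, [(Crs True, 4), (Crs True, 2)]), (9, 2, [(Crs True, 4), (Crs False, 0)]),
       (8, 2, [(Crs True, 4), (Crs True, 1)]), (7, 2, [(Crs True, 4), (Crs False, 0)]),
       (6, 2, [(Crs True, 4), (Crs True, 1)]), (5, 2, [(Crs True, 2), (Cup, 2)]),
       (4, 2, [(Crs True, 2), (Crs False, 0)]), (5, 0, [(Crs True, 1), (Crs False, 1)]),
       (3, 3, [(Crs True, 2), (Crs True, 1), (Crs True, 2)]), (2, 2, []), (1, 2, [(Cup, 1)]),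
       (1, 2, [(Cup, 2), (Crs False, 1)]), (0, 2, [(Cup, 0), (Cup, 0)]), (1, 2, [(Cup, 1),
       (Crs True, 0)]), (5, 0, [(Crs False, 1), (Crs True, 1)]), (3, 3, [(Crs False, 0),
       (Crs False, 1), (Crs False, 0)]), (2, 2, []), (1, 2, [(Cup, 1)]), (4, 2, [(Cup, 1),
       (Crs False, 2)]), (3, 2, [(Cup, 1), (Crs True, 3)]), (5, 2, [(Crs False, 0),
       (Crs False, 2)]), (4, 2, [(Crs False, 0), (Crs True, 3)]), (8, 2, [(Crs True, 2),
       (Crs False, 0)]), (9, 0, [(Crs True, 1), (Crs False, 1)]), (7, 3, [(Crs True, 2),
       (Crs True, 1), (Crs True, 2)]), (6, 2, []), (5, 2, [(Crs True, 1), (Crs True, 3)]),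
       (9, 2, [(Cap, 3), (Crs False, 0)]), (8, 2, [(Cap, 3), (Crs False, 1)]),
       (7, 2, [(Crs False, 3), (Cap, 2)]), (6, 2, []), (8, 2, [(Crs False, 2), (Crs False, 0)]),
       (9, 2, [(Crs True, 1), (Cap, 0)]), (7, 0, [(Crs True, 2), (Crs False, 2)]),
       (8, 3, [(Crs False, 1), (Crs False, 2), (Crs False, 1)]), (10, 2, []), (9, 2, [(Cap, 0),
       (Crs False, 0)]), (10, 2, [(Cap, 0)]), (1, 2, [(Cup, 0), (Crs True, 1)]), (0, 2, [(Cup, 0),
       (Cup, 2)]), (2, 2, [(Cup, 1), (Crs True, 3)]), (3, 2, [(Crs False, 0), (Crs True, 3)]),
       (4, 2, [(Crs True, 1), (Crs True, 3)]), (1, 2, [(Cup, 1), (Cup, 4)]),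
       (2, 2, [(Crs False, 0), (Cup, 4)]), (3, 2, [(Crs True, 1), (Cup, 4)]), (4, 2, [(Cup, 3),
       (Crs False, 4)]), (5, 2, [(Cap, 2), (Crs False, 2)]), (6, 2, []), (4, 2, []), (3, 2, []),
       (2, 2, [(Cap, 0)]), (1, 2, [])]
      unknot"
    by code_simp
qed (code_simp+)

section \<open>From bands to the H(2)-unknotting number\<close>

lemma band_unknots_mirror: "band_unknots D \<Longrightarrow> band_unknots (mirror D)"
  unfolding band_unknots_def by (metis isotopic_mirror H2_move_mirror mirror_unknot)

text \<open>The band gives one move, the isotopy between consecutive moves being absorbed by
  reflexivity. Zero moves would leave an isotopy from \<open>D\<close> to the unknot, because the
  zeroth relational power is equality.\<close>

lemma H2_unknotting_number_eq_1:
  assumes "band_unknots D" "\<not> isotopic D unknot"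
  shows "H2_unknotting_number D = 1"
proof -
  have one: "unknots_by_H2_moves D 1"
    using assms(1) unfolding unknots_by_H2_moves_def band_unknots_def
    by (auto simp: OO_def intro: isotopic_refl)
  have zero: "\<not> unknots_by_H2_moves D 0"
    using assms(2) by (simp add: unknots_by_H2_moves_def)
  show ?thesis
    unfolding H2_unknotting_number_def
  proof (rule antisym)
    show "Inf {enat n |n. unknots_by_H2_moves D n} \<le> 1"
      using one by (intro Inf_lower) (auto simp: one_enat_def)
    show "1 \<le> Inf {enat n |n. unknots_by_H2_moves D n}"
    proof (rule Inf_greatest)
      fix x assume "x \<in> {enat n |n. unknots_by_H2_moves D n}"
      then obtain n where "x = enat n" "unknots_by_H2_moves D n" by blast
      with zero show "1 \<le> x" by (cases n) (auto simp: one_enat_def)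
    qed
  qed
qed

theorem corollary1p2:
  fixes K D :: diagram
  assumes "K \<in> {knot_9_21, knot_9_23, knot_9_26, knot_9_31}"
    and "isotopic_up_to_mirror D K"
  shows "H2_unknotting_number D = 1"
proof -
  have "band_unknots K"
    using assms(1) band_unknots_knot_9_21 band_unknots_knot_9_23 band_unknots_knot_9_26
      band_unknots_knot_9_31 by auto
  moreover obtain K' where "K' \<in> {K, mirror K}" and D: "isotopic D K'"
    using assms(2) by (auto simp: isotopic_up_to_mirror_def)
  ultimately have "band_unknots K'" "\<not> isotopic K' unknot"
    using band_unknots_mirror knots_not_isotopic_unknot[OF assms(1)] by auto
  \<comment> \<open>Both properties depend only on the isotopy class, so they pass from
    \<open>K'\<close> to \<open>D\<close>.\<close>
  then have "band_unknots D" "\<not> isotopic D unknot"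
    using D isotopic_trans isotopic_sym unfolding band_unknots_def by blast+
  then show ?thesis by (rule H2_unknotting_number_eq_1)
qed

end
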